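(* Let $\{x(t)\}_{t\ge 0}$ be the iterates generated by the asynchronous network Newton algorithm (defined in the context) with stepsize parameter $\varepsilon$ satisfying $$0<\varepsilon<\min\Big\{\frac12,\;2\pi\Big(\frac{\lambda}{\Lambda}\Big)^{2}\Big\}.$$ Then the sequences $\{F(x(t))\}$ and $\{x(t)\}$ converge linearly in expectation to their optimal values; that is, with $$\beta=\frac{\alpha m\varepsilon(2\pi\lambda^{2}-\varepsilon\Lambda^{2})}{\lambda\pi}$$ one has $0<\beta<1$ and, for all $t\ge 0$, $$\mathbb{E}\big[F(x(t))-F^*\big]\leq(1-\beta)^{t}\big[F(x(0))-F^*\big]$$ and $$\mathbb{E}\big[\|x(t)-x^*\|\big]\leq\Bigg(\frac{2\big(F(x(0))-F^*\big)}{\alpha m}\Bigg)^{1/2}\Big((1-\beta)^{1/2}\Big)^t.$$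
   Context: Problem. There are $n$ agents connected by an undirected static graph $(\mathcal V,\mathcal E)$. The problem is to minimize over $x=[x_1,\dots,x_n]'\in\mathbb{R}^n$ the function $F(x)=\frac12 x'(I-W)x+\alpha\sum_{i=1}^n f_i(x_i)$, where $\alpha>0$ and $f_i:\mathbb{R}\to\mathbb{R}$. The matrix $W\in\mathbb{R}^{n\times n}$ satisfies $W'=W$, $W\mathbf 1=\mathbf 1$, $\mathrm{null}(I-W)=\mathrm{span}\{\mathbf 1\}$, $0\le W_{ij}<1$, and for $i\ne j$, $W_{ij}\neq 0$ if and only if $(i,j)\in\mathcal E$. Let $x^*$ be the minimizer of $F$ and $F^*=F(x^* )$. Norms are Euclidean (and the induced matrix norm). Standing assumptions. (1) Each $f_i$ is convex, twice continuously differentiable, and $0<m\le \nabla^2 f_i(s)\le M<\infty$ for all $s\in\mathbb{R}$. (2) Each $\nabla^2 f_i$ is $L$-Lipschitz: $|\nabla^2 f_i(s)-\nabla^2 f_i(\bar s)|\le L|s-\bar s|$. (3) There are $0<\delta\le\Delta<1$ with $\delta\le W_{ii}\le\Delta$ for all $i$. (4) The activation probabilities $p_1,\dots,p_n$ satisfy $\sum_i p_i=1$ and $0<\pi\le p_i\le\Pi<1$ (here $\pi,\Pi$ are given scalars). $P$ is the diagonal matrix with $P_{ii}=p_i$. Notation. $g(t)=\nabla F(x(t))$; $H(t)=\nabla^2F(x(t))$; $G(t)$ is diagonal with $G_{ii}(t)=\nabla^2 f_i(x_i(t))$; $W_d$ is diagonal with $[W_d]_{ii}=W_{ii}$; $D(t)=\alpha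 G(t)+2(I-W_d)$; $B=I-2W_d+W$ (so $H(t)=D(t)-B$); $\hat H(t)^{-1}=D(t)^{-1/2}\big[I+D(t)^{-1/2}BD(t)^{-1/2}\big]D(t)^{-1/2}$. Constants. $\rho=\frac{2(1-\delta)}{2(1-\delta)+\alpha m}$, $\Lambda=\frac{1+\rho}{2(1-\Delta)+\alpha m}$, $\lambda=\frac{1}{2(1-\delta)+\alpha M}$. Algorithm (asynchronous network Newton). $x(0)=0$. At each iteration $t=1,2,\dots$ exactly one agent is active, agent $i$ with probability $p_i$. Let $\Phi(t)$ be the random diagonal $n\times n$ matrix with $\Phi(t)_{ii}=1$ if agent $i$ is active at time $t$ and $0$ otherwise; $\mathcal F_t$ is the $\sigma$-field capturing all activations up to and including time $t$. Conditionally on $\mathcal F_{t-1}$, $\Phi(t)=\Phi^i$ with probability $p_i$, where $\Phi^i$ is the diagonal matrix with $i$-th diagonal entry $1$ and all others $0$. The update is $x(t)=x(t-1)-\varepsilon P^{-1}\Phi(t)\hat H(t-1)^{-1}g(t-1)$. *)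

theory Defs
  imports "HOL-Probability.Probability"
begin

definition diag_mat :: "real ^ 'n \<Rightarrow> real ^ 'n ^ 'n" where
  "diag_mat v = (\<chi> i j. if i = j then v $ i else 0)"

definition diag_part :: "real ^ 'n ^ 'n \<Rightarrow> real ^ 'n ^ 'n" where
  "diag_part A = diag_mat (\<chi> i. A $ i $ i)"

text \<open>Real power of a diagonal matrix with positive diagonal; meaningless for other matrices.\<close>

definition diag_powr :: "real ^ 'n ^ 'n \<Rightarrow> real \<Rightarrow> real ^ 'n ^ 'n" where
  "diag_powr A r = diag_mat (\<chi> i. (A $ i $ i) powr r)"

definition gradient :: "('a::real_inner \<Rightarrow> real) \<Rightarrow> 'a \<Rightarrow> 'a" where
  "gradient F x = (THE d. GDERIV F x :> d)"

definition objective ::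
  "real \<Rightarrow> ('n \<Rightarrow> real \<Rightarrow> real) \<Rightarrow> real ^ 'n ^ 'n \<Rightarrow> real ^ 'n \<Rightarrow> real" where
  "objective \<alpha> f W x =
     1/2 * (x \<bullet> ((mat 1 - W) *v x)) + \<alpha> * (\<Sum>i\<in>UNIV. f i (x $ i))"

definition hess_diag :: "('n \<Rightarrow> real \<Rightarrow> real) \<Rightarrow> real ^ 'n \<Rightarrow> real ^ 'n ^ 'n" where
  "hess_diag f x = diag_mat (\<chi> i. deriv (deriv (f i)) (x $ i))"

text \<open>The splitting \<open>H = D - B\<close> of the Hessian of the objective, and the approximate inverse
  obtained by keeping the first two terms of the Neumann series of
  \<open>(I - D\<^sup>-\<^sup>1\<^sup>/\<^sup>2 B D\<^sup>-\<^sup>1\<^sup>/\<^sup>2)\<^sup>-\<^sup>1\<close>.\<close>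

definition D_mat ::
  "real \<Rightarrow> ('n \<Rightarrow> real \<Rightarrow> real) \<Rightarrow> real ^ 'n ^ 'n \<Rightarrow> real ^ 'n \<Rightarrow> real ^ 'n ^ 'n" where
  "D_mat \<alpha> f W x = \<alpha> *\<^sub>R hess_diag f x + 2 *\<^sub>R (mat 1 - diag_part W)"

definition B_mat :: "real ^ 'n ^ 'n \<Rightarrow> real ^ 'n ^ 'n" where
  "B_mat W = mat 1 - 2 *\<^sub>R diag_part W + W"

definition Hhat_inv ::
  "real \<Rightarrow> ('n \<Rightarrow> real \<Rightarrow> real) \<Rightarrow> real ^ 'n ^ 'n \<Rightarrow> real ^ 'n \<Rightarrow> real ^ 'n ^ 'n" where
  "Hhat_inv \<alpha> f W x =
     (let R = diag_powr (D_mat \<alpha> f W x) (- 1/2)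
      in R ** (mat 1 + R ** B_mat W ** R) ** R)"

definition activation_mat :: "'n \<Rightarrow> real ^ 'n ^ 'n" where
  "activation_mat i = diag_mat (axis i 1)"

text \<open>The sigma-field generated by the active agents \<open>a 1, \<dots>, a t\<close>; it is trivial for \<open>t = 0\<close>.\<close>

definition activation_field :: "'w measure \<Rightarrow> (nat \<Rightarrow> 'w \<Rightarrow> 'n) \<Rightarrow> nat \<Rightarrow> 'w measure" where
  "activation_field \<Omega> a t =
     sigma (space \<Omega>) {a s -` A \<inter> space \<Omega> | s A. 1 \<le> s \<and> s \<le> t}"

end

theory Submission
  imports Defs
begin

text \<open>
  Write \<open>d\<close> for the approximate inverse Hessian applied to \<open>g = \<nabla>F\<close>. Activating agent \<open>i\<close>
  changes only coordinate \<open>i\<close>, along which the curvature of \<open>F\<close> is at most \<open>1/\<lambda>\<close>.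
  Averaging the resulting quadratic upper bounds over \<open>i\<close>
  cancels the factors \<open>1/p\<^sub>i\<close> in the linear term, so the expected decrease is at least
  \<open>\<epsilon> g \<bullet> d - \<epsilon>\<^sup>2 |d|\<^sup>2 / (2 \<lambda> \<pi>)\<close>. Because \<open>B\<close> is positive semidefinite and dominated by
  \<open>2 (I - W\<^sub>d) \<le> \<rho> D\<close>, the approximate inverse Hessian lies between \<open>\<lambda> I\<close> and \<open>\<Lambda> I\<close>; with the
  Polyak-Lojasiewicz inequality \<open>|g|\<^sup>2 \<ge> 2 \<alpha> m (F - F\<^sup>*)\<close> this is a contraction by \<open>1 - \<beta>\<close>.
  The bound on the iterates follows from quadratic growth at the minimizer and Jensen's inequality.

  The iterates take finitely many values, so measurability and integrability reduce to
  statements about simple functions.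
\<close>

subsection \<open>Second-order bounds and diagonal matrices\<close>

text \<open>The Lagrange form of the remainder gives an exact second-order expansion with
  \<open>deriv (deriv f)\<close> taken at an intermediate point \<open>c\<close>; the two bounds are
  read off there.\<close>

lemma second_order_taylor_bounds:
  fixes f :: "real \<Rightarrow> real"
  assumes f1: "f differentiable_on UNIV" and f2: "deriv f differentiable_on UNIV"
    and bounds: "\<And>s. m \<le> deriv (deriv f) s \<and> deriv (deriv f) s \<le> M"
  shows "f x + deriv f x * (y - x) + m / 2 * (y - x)\<^sup>2 \<le> f y"
    and "f y \<le> f x + deriv f x * (y - x) + M / 2 * (y - x)\<^sup>2"
proof -
  have d1: "DERIV f s :> deriv f s" for s
    using f1 by (simp add: DERIV_deriv_iff_real_differentiable differentiable_on_def)
  have d2: "DERIV (deriv f) s :> deriv (deriv f) s" for s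
    using f2 by (simp add: DERIV_deriv_iff_real_differentiable differentiable_on_def)
  have "\<exists>c. f y = f x + deriv f x * (y - x) + deriv (deriv f) c / 2 * (y - x)\<^sup>2"
  proof (cases "y = x")
    case False
    define diff where "diff = (\<lambda>k::nat. if k = 0 then f else if k = 1 then deriv f else deriv (deriv f))"
    have "\<forall>k t. k < 2 \<and> min x y \<le> t \<and> t \<le> max x y \<longrightarrow> DERIV (diff k) t :> diff (Suc k) t"
      using d1 d2 by (auto simp: diff_def less_2_cases_iff)
    then obtain c where "f y = (\<Sum>k<2. diff k x / fact k * (y - x) ^ k) + diff 2 c / fact 2 * (y - x) ^ 2"
      using Taylor[of 2 diff f "min x y" "max x y" x y] False by (auto simp: diff_def)
    thus ?thesis
      by (auto simp: diff_def numeral_2_eq_2)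
  qed auto
  then obtain c where c: "f y = f x + deriv f x * (y - x) + deriv (deriv f) c / 2 * (y - x)\<^sup>2" ..
  have "m / 2 * (y - x)\<^sup>2 \<le> deriv (deriv f) c / 2 * (y - x)\<^sup>2"
    "deriv (deriv f) c / 2 * (y - x)\<^sup>2 \<le> M / 2 * (y - x)\<^sup>2"
    using bounds[of c] by (auto intro!: mult_right_mono)
  with c show "f x + deriv f x * (y - x) + m / 2 * (y - x)\<^sup>2 \<le> f y"
    and "f y \<le> f x + deriv f x * (y - x) + M / 2 * (y - x)\<^sup>2" by linarith+
qed

lemma diag_mat_nth [simp]: "diag_mat v $ i $ j = (if i = j then v $ i else 0)"
  by (simp add: diag_mat_def)

lemma diag_mat_mult_vec_nth [simp]: "(diag_mat v *v y) $ i = v $ i * y $ i"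
  by (simp add: matrix_vector_mult_def if_distrib if_distribR cong: if_cong)

lemma diag_mat_mult: "diag_mat u ** diag_mat v = diag_mat (\<chi> i. u $ i * v $ i)"
proof -
  have "(\<Sum>k\<in>UNIV. (if i = k then u $ i else 0) * (if k = j then v $ k else 0))
      = (\<Sum>k\<in>UNIV. if k = i then u $ i * (if i = j then v $ i else 0) else 0)" for i j
    by (rule sum.cong) auto
  thus ?thesis by (simp add: matrix_matrix_mult_def vec_eq_iff)
qed

lemma diag_mat_one: "diag_mat 1 = mat 1"
  by (simp add: vec_eq_iff mat_def)

lemma matrix_inv_diag_mat:
  assumes "\<And>i. v $ i \<noteq> 0"
  shows "matrix_inv (diag_mat v) = diag_mat (\<chi> i. inverse (v $ i))"
proof -
  define V where "V = diag_mat (\<chi> i. inverse (v $ i))"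
  have "(\<chi> i. v $ i * (\<chi> i. inverse (v $ i)) $ i) = 1" "(\<chi> i. (\<chi> i. inverse (v $ i)) $ i * v $ i) = 1"
    using assms by (simp_all add: vec_eq_iff)
  hence V: "diag_mat v ** V = mat 1" "V ** diag_mat v = mat 1"
    unfolding V_def diag_mat_mult diag_mat_one[symmetric] by simp_all
  \<comment> \<open>\<open>matrix_inv\<close> is a choice among two-sided inverses. \<open>V\<close>
    shows that one exists, and multiplying by \<open>V\<close> then identifies the chosen
    one.\<close>
  hence "matrix_inv (diag_mat v) ** diag_mat v = mat 1"
    unfolding matrix_inv_def by (rule someI2[where a = V, OF conjI]) auto
  hence "matrix_inv (diag_mat v) ** (diag_mat v ** V) = V"
    by (simp only: matrix_mul_assoc matrix_mul_lid)
  hence "matrix_inv (diag_mat v) = V" by (simp only: V matrix_mul_rid)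
  thus ?thesis by (simp only: V_def)
qed

lemma matrix_mult_add_rdistrib:
  fixes A B :: "'a::semiring_1 ^ 'n ^ 'm"
  shows "(A + B) ** C = A ** C + B ** C"
  by (simp add: matrix_matrix_mult_def vec_eq_iff sum.distrib distrib_right)

lemma diag_mat_inner: "u \<bullet> (diag_mat e *v v) = (diag_mat e *v u) \<bullet> v"
  by (simp add: inner_vec_def algebra_simps)

lemma power2_norm_vec_eq_sum: "(norm (v :: real ^ 'n))\<^sup>2 = (\<Sum>i\<in>UNIV. (v $ i)\<^sup>2)"
  unfolding dot_square_norm[symmetric] inner_vec_def by (simp add: power2_eq_square)

lemma symmetric_matrix_inner:
  fixes A :: "real ^ 'n ^ 'n"
  assumes "transpose A = A"
  shows "u \<bullet> (A *v v) = (A *v u) \<bullet> v"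
  using assms dot_lmul_matrix[of u A v] by (metis transpose_matrix_vector)

lemma inj_activation_mat: "activation_mat i = activation_mat j \<longleftrightarrow> i = j"
proof
  assume "activation_mat i = activation_mat j"
  hence "(activation_mat i :: real^_^_) $ i $ i = activation_mat j $ i $ i" by simp
  thus "i = j" by (simp add: activation_mat_def axis_def split: if_splits)
qed simp

text \<open>Positive semidefiniteness applied to \<open>v - u / c\<close> with \<open>u = A v\<close> gives \<open>A\<^sup>2 \<le> c A\<close>.\<close>

lemma norm_le_of_quadratic_form_le:
  fixes A :: "real ^ 'n ^ 'n"
  assumes sym: "\<And>u v. u \<bullet> (A *v v) = (A *v u) \<bullet> v" and psd: "\<And>v. 0 \<le> v \<bullet> (A *v v)"
    and le: "\<And>v. v \<bullet> (A *v v) \<le> c * (norm v)\<^sup>2" and c: "c > 0"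
  shows "(norm (A *v v))\<^sup>2 \<le> c\<^sup>2 * (norm v)\<^sup>2"
proof -
  define u where "u = A *v v"
  have "0 \<le> (v - inverse c *\<^sub>R u) \<bullet> (A *v (v - inverse c *\<^sub>R u))" by (rule psd)
  also have "\<dots> = v \<bullet> (A *v v) - 2 * inverse c * (u \<bullet> u) + (inverse c)\<^sup>2 * (u \<bullet> (A *v u))"
    using sym[of v u] by (simp add: u_def[symmetric] matrix_vector_mult_diff_distrib
        matrix_vector_mult_scaleR inner_diff_left inner_diff_right power2_eq_square inner_commute
        right_diff_distrib)
  also have "\<dots> \<le> v \<bullet> (A *v v) - 2 * inverse c * (u \<bullet> u) + (inverse c)\<^sup>2 * (c * (norm u)\<^sup>2)"
    using le[of u] by (intro add_left_mono mult_left_mono) auto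
  also have "\<dots> = v \<bullet> (A *v v) - inverse c * (norm u)\<^sup>2"
    using c by (simp add: power2_norm_eq_inner[symmetric] power2_eq_square)
  also have "\<dots> \<le> c * (norm v)\<^sup>2 - inverse c * (norm u)\<^sup>2" using le[of v] by simp
  finally have "inverse c * (norm u)\<^sup>2 \<le> c * (norm v)\<^sup>2" by simp
  hence "c * (inverse c * (norm u)\<^sup>2) \<le> c * (c * (norm v)\<^sup>2)"
    using c by (intro mult_left_mono) auto
  thus ?thesis using c by (simp add: u_def power2_eq_square mult.assoc[symmetric])
qed

subsection \<open>The penalized consensus objective\<close>

text \<open>Only the deterministic data: every bound below holds at an arbitrary point
  \<open>x\<close> and is applied pathwise later.\<close>

locale consensus_objective =
  fixes \<alpha> :: real and f :: "'n::finite \<Rightarrow> real \<Rightarrow> real" and W :: "real ^ 'n ^ 'n"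
    and m M \<delta> \<Delta> :: real
  assumes alpha_pos: "0 < \<alpha>"
    and W_symmetric: "transpose W = W"
    and W_stochastic: "W *v 1 = 1"
    and W_nonneg: "\<And>i j. 0 \<le> W $ i $ j"
    and W_diag: "\<And>i. \<delta> \<le> W $ i $ i" "\<And>i. W $ i $ i \<le> \<Delta>"
    and Delta: "\<Delta> < 1"
    and f_diff: "\<And>i. f i differentiable_on UNIV" "\<And>i. deriv (f i) differentiable_on UNIV"
    and f_hess_bounds: "\<And>i s. m \<le> deriv (deriv (f i)) s \<and> deriv (deriv (f i)) s \<le> M"
    and m_pos: "0 < m"
begin

abbreviation F :: "real ^ 'n \<Rightarrow> real" where "F \<equiv> objective \<alpha> f W"

text \<open>\<open>1 / lam\<close> bounds the entries of \<open>D\<close> from above, and the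
  denominator of \<open>Lam\<close> bounds them from below. The factor \<open>1 + \<rho>\<close> in
  \<open>Lam\<close> accounts for the second Neumann term.\<close>

abbreviation lam :: real where "lam \<equiv> 1 / (2 * (1 - \<delta>) + \<alpha> * M)"

abbreviation \<rho> :: real where "\<rho> \<equiv> 2 * (1 - \<delta>) / (2 * (1 - \<delta>) + \<alpha> * m)"

abbreviation Lam :: real where "Lam \<equiv> (1 + \<rho>) / (2 * (1 - \<Delta>) + \<alpha> * m)"

lemma delta_less_1: "\<delta> < 1"
  using W_diag[of undefined] Delta by linarith

lemma m_le_M: "m \<le> M"
  using f_hess_bounds[of undefined undefined] by linarith

lemma M_pos: "0 < M"
  using m_le_M m_pos by linarith

lemma lam_pos: "0 < lam"
  using delta_less_1 alpha_pos M_pos by (simp add: add_pos_pos)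

lemma rho_pos: "0 < \<rho>"
  using delta_less_1 alpha_pos m_pos by (simp add: add_pos_pos)

lemma Lam_pos: "0 < Lam"
proof (rule divide_pos_pos)
  show "0 < 1 + \<rho>" using rho_pos by linarith
  show "0 < 2 * (1 - \<Delta>) + \<alpha> * m"
    using Delta alpha_pos m_pos by (intro add_pos_pos) auto
qed

section \<open>Quadratic forms of \<open>I - W\<close> and \<open>B\<close>\<close>

lemma W_row_sum: "(\<Sum>j\<in>UNIV. W $ i $ j) = 1"
  using W_stochastic by (simp add: matrix_vector_mult_def vec_eq_iff)

lemma W_commute: "W $ i $ j = W $ j $ i"
  using W_symmetric by (metis transpose_def vec_lambda_beta)

text \<open>The case \<open>s = -1\<close> is the quadratic form of \<open>I - W\<close>; the case \<open>s = 1\<close> is that of \<open>B\<close> up to diagonal terms.\<close>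

lemma W_sum_squares:
  assumes "s\<^sup>2 = 1"
  shows "(\<Sum>i\<in>UNIV. \<Sum>j\<in>UNIV. W $ i $ j * (z $ i + s * z $ j)\<^sup>2) = 2 * (z \<bullet> z) + 2 * s * (z \<bullet> (W *v z))"
proof -
  have 1: "(\<Sum>i\<in>UNIV. \<Sum>j\<in>UNIV. W $ i $ j * (z $ i)\<^sup>2) = z \<bullet> z"
    by (simp add: sum_distrib_right[symmetric] W_row_sum inner_vec_def power2_eq_square)
  have 2: "(\<Sum>i\<in>UNIV. \<Sum>j\<in>UNIV. W $ i $ j * (z $ j)\<^sup>2) = z \<bullet> z"
    by (subst sum.swap, subst W_commute, rule 1)
  have 3: "(\<Sum>i\<in>UNIV. \<Sum>j\<in>UNIV. W $ i $ j * (z $ i * z $ j)) = z \<bullet> (W *v z)"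
    by (simp add: inner_vec_def matrix_vector_mult_def sum_distrib_left mult_ac)
  have "W $ i $ j * (z $ i + s * z $ j)\<^sup>2 = W $ i $ j * (z $ i)\<^sup>2 + W $ i $ j * (z $ j)\<^sup>2
      + 2 * s * (W $ i $ j * (z $ i * z $ j))" for i j
    using assms by (simp add: power2_sum power_mult_distrib algebra_simps)
  thus ?thesis by (simp add: sum.distrib sum_distrib_left[symmetric] 1 2 3)
qed

text \<open>The form is half the sum of the terms
  \<open>W $ i $ j * (z $ i - z $ j)^2\<close>.\<close>

lemma Laplacian_psd: "0 \<le> z \<bullet> ((mat 1 - W) *v z)"
proof -
  have "0 \<le> (\<Sum>i\<in>UNIV. \<Sum>j\<in>UNIV. W $ i $ j * (z $ i + (-1) * z $ j)\<^sup>2)"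
    by (intro sum_nonneg mult_nonneg_nonneg W_nonneg) auto
  thus ?thesis
    by (subst (asm) W_sum_squares) (auto simp: matrix_vector_mult_diff_rdistrib inner_diff_right)
qed

lemma Laplacian_inner: "u \<bullet> ((mat 1 - W) *v v) = ((mat 1 - W) *v u) \<bullet> v"
  using symmetric_matrix_inner[OF W_symmetric, of u v]
  by (simp add: matrix_vector_mult_diff_rdistrib inner_diff_right inner_diff_left)

lemma B_inner: "u \<bullet> (B_mat W *v v) = (B_mat W *v u) \<bullet> v"
  using symmetric_matrix_inner[OF W_symmetric, of u v]
  by (simp add: B_mat_def diag_part_def matrix_vector_mult_diff_rdistrib
      matrix_vector_mult_add_rdistrib inner_diff_right inner_diff_left inner_add_left
      inner_add_right scaleR_matrix_vector_assoc[symmetric] diag_mat_inner)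

lemma B_quadratic_form:
  "z \<bullet> (B_mat W *v z) = z \<bullet> z - 2 * (\<Sum>i\<in>UNIV. W $ i $ i * (z $ i)\<^sup>2) + z \<bullet> (W *v z)"
proof -
  have "z \<bullet> (diag_mat (\<chi> i. W $ i $ i) *v z) = (\<Sum>i\<in>UNIV. W $ i $ i * (z $ i)\<^sup>2)"
    by (simp add: inner_vec_def power2_eq_square mult_ac)
  thus ?thesis
    by (simp add: B_mat_def diag_part_def matrix_vector_mult_diff_rdistrib
      matrix_vector_mult_add_rdistrib inner_diff_right inner_add_right
      scaleR_matrix_vector_assoc[symmetric])
qed

text \<open>In the sum of \<open>W $ i $ j * (z $ i + z $ j)^2\<close> the diagonal terms contribute
  \<open>4 * W $ i $ i * (z $ i)^2\<close>; what remains is nonnegative and equals twice the form of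
  \<open>B\<close>.\<close>

lemma B_psd: "0 \<le> z \<bullet> (B_mat W *v z)"
proof -
  have "(\<Sum>i\<in>UNIV. W $ i $ i * (z $ i + 1 * z $ i)\<^sup>2)
      \<le> (\<Sum>i\<in>UNIV. \<Sum>j\<in>UNIV. W $ i $ j * (z $ i + 1 * z $ j)\<^sup>2)"
    by (intro sum_mono member_le_sum mult_nonneg_nonneg W_nonneg) auto
  also have "\<dots> = 2 * (z \<bullet> z) + 2 * (z \<bullet> (W *v z))" by (subst W_sum_squares) auto
  also have "(\<Sum>i\<in>UNIV. W $ i $ i * (z $ i + 1 * z $ i)\<^sup>2) = 4 * (\<Sum>i\<in>UNIV. W $ i $ i * (z $ i)\<^sup>2)"
    by (simp add: sum_distrib_left power2_eq_square algebra_simps)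
  finally show ?thesis by (simp add: B_quadratic_form)
qed

text \<open>The difference \<open>2 (I - W_d) - B\<close> is \<open>I - W\<close>, which is positive
  semidefinite.\<close>

lemma B_upper: "z \<bullet> (B_mat W *v z) \<le> (\<Sum>i\<in>UNIV. 2 * (1 - W $ i $ i) * (z $ i)\<^sup>2)"
proof -
  have "(\<Sum>i\<in>UNIV. 2 * (1 - W $ i $ i) * (z $ i)\<^sup>2)
      = 2 * (z \<bullet> z) - 2 * (\<Sum>i\<in>UNIV. W $ i $ i * (z $ i)\<^sup>2)"
    by (simp add: algebra_simps sum_subtractf sum_distrib_left inner_vec_def power2_eq_square)
  thus ?thesis
    using Laplacian_psd[of z]
    by (simp add: B_quadratic_form matrix_vector_mult_diff_rdistrib inner_diff_right)
qed

section \<open>Spectral bounds on the approximate inverse Hessian\<close>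

definition D_diag :: "real ^ 'n \<Rightarrow> 'n \<Rightarrow> real" where
  "D_diag x i = \<alpha> * deriv (deriv (f i)) (x $ i) + 2 * (1 - W $ i $ i)"

lemma D_mat_diag: "D_mat \<alpha> f W x $ i $ i = D_diag x i"
  by (simp add: D_mat_def hess_diag_def diag_part_def D_diag_def mat_def)

lemma D_diag_lower: "2 * (1 - \<Delta>) + \<alpha> * m \<le> D_diag x i"
  unfolding D_diag_def using W_diag[of i] f_hess_bounds[of i "x $ i"] alpha_pos
  by (subst add.commute, intro add_mono mult_left_mono) auto

lemma D_diag_upper: "D_diag x i \<le> 2 * (1 - \<delta>) + \<alpha> * M"
  unfolding D_diag_def using W_diag[of i] f_hess_bounds[of i "x $ i"] alpha_pos
  by (subst add.commute, intro add_mono mult_left_mono) auto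

lemma D_diag_pos: "0 < D_diag x i"
proof -
  have "0 < 2 * (1 - \<Delta>) + \<alpha> * m" using Delta alpha_pos m_pos by (intro add_pos_pos) auto
  thus ?thesis using D_diag_lower[of x i] by (rule less_le_trans)
qed

text \<open>With \<open>s = 2 * (1 - W $ i $ i)\<close> one has
  \<open>D_diag x i >= s + \<alpha> * m\<close>, and \<open>s / (s + \<alpha> * m)\<close> increases
  in \<open>s\<close> up to its value \<open>\<rho>\<close> at
  \<open>s = 2 * (1 - \<delta>)\<close>.\<close>

lemma W_diag_le_rho: "2 * (1 - W $ i $ i) \<le> \<rho> * D_diag x i"
proof -
  have am: "0 < \<alpha> * m" using alpha_pos m_pos by simp
  have w: "0 < 1 - W $ i $ i" "1 - W $ i $ i \<le> 1 - \<delta>" using W_diag[of i] Delta by auto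
  have "2 * (1 - W $ i $ i) * (2 * (1 - \<delta>) + \<alpha> * m)
      = 2 * (1 - \<delta>) * (2 * (1 - W $ i $ i)) + 2 * (\<alpha> * m) * (1 - W $ i $ i)"
    by (simp add: algebra_simps)
  also have "\<dots> \<le> 2 * (1 - \<delta>) * (2 * (1 - W $ i $ i)) + 2 * (\<alpha> * m) * (1 - \<delta>)"
    using w am by (intro add_left_mono mult_left_mono) auto
  also have "\<dots> = 2 * (1 - \<delta>) * (\<alpha> * m + 2 * (1 - W $ i $ i))" by (simp add: algebra_simps)
  also have "\<dots> \<le> 2 * (1 - \<delta>) * D_diag x i"
    using f_hess_bounds[of i "x $ i"] alpha_pos delta_less_1
    by (intro mult_left_mono) (auto simp: D_diag_def)
  finally show ?thesis
    using am delta_less_1 by (simp add: pos_le_divide_eq)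
qed

text \<open>Multiplying out, the square roots occur only as \<open>R ** R\<close>, which is the
  inverse of \<open>D\<close>. Real powers disappear from here on.\<close>

lemma Hhat_inv_eq:
  fixes x
  defines "E \<equiv> diag_mat (\<chi> i. 1 / D_diag x i)"
  shows "Hhat_inv \<alpha> f W x = E + E ** B_mat W ** E"
proof -
  define R where "R = diag_powr (D_mat \<alpha> f W x) (-1/2)"
  have "D_diag x i powr - (1/2) * D_diag x i powr - (1/2) = 1 / D_diag x i" for i
    using D_diag_pos[of x i] powr_minus_divide[of "D_diag x i" 1]
    by (simp only: powr_add[symmetric]) simp
  hence "R ** R = E"
    unfolding R_def diag_powr_def diag_mat_mult E_def by (simp add: D_mat_diag)
  moreover have "Hhat_inv \<alpha> f W x = R ** R + (R ** R) ** B_mat W ** (R ** R)"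
    unfolding Hhat_inv_def R_def[symmetric] Let_def
    by (simp add: matrix_add_ldistrib matrix_mult_add_rdistrib matrix_mul_assoc)
  ultimately show ?thesis by simp
qed

lemma Hhat_inv_inner: "u \<bullet> (Hhat_inv \<alpha> f W x *v v) = (Hhat_inv \<alpha> f W x *v u) \<bullet> v"
  by (simp add: Hhat_inv_eq matrix_vector_mult_add_rdistrib inner_add_left inner_add_right
      matrix_vector_mul_assoc[symmetric] diag_mat_inner B_inner)

text \<open>Symmetry of the diagonal factor turns the second term into the form of \<open>B\<close>
  at the rescaled vector \<open>z\<close>, where \<open>B_psd\<close> and \<open>B_upper\<close>
  apply.\<close>

lemma Hhat_inv_quadratic_form:
  fixes x v
  defines "z \<equiv> \<chi> i. v $ i / D_diag x i"
  shows "v \<bullet> (Hhat_inv \<alpha> f W x *v v) = (\<Sum>i\<in>UNIV. (v $ i)\<^sup>2 / D_diag x i) + z \<bullet> (B_mat W *v z)"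
proof -
  have "diag_mat (\<chi> i. 1 / D_diag x i) *v v = z" by (simp add: vec_eq_iff z_def)
  moreover have "v \<bullet> z = (\<Sum>i\<in>UNIV. (v $ i)\<^sup>2 / D_diag x i)"
    by (simp add: inner_vec_def z_def power2_eq_square)
  ultimately show ?thesis
    by (simp add: Hhat_inv_eq matrix_vector_mult_add_rdistrib inner_add_right
        matrix_vector_mul_assoc[symmetric] diag_mat_inner)
qed

lemma Hhat_inv_lower: "lam * (norm v)\<^sup>2 \<le> v \<bullet> (Hhat_inv \<alpha> f W x *v v)"
proof -
  have "lam * (norm v)\<^sup>2 = (\<Sum>i\<in>UNIV. (v $ i)\<^sup>2 / (2 * (1 - \<delta>) + \<alpha> * M))"
    by (simp add: power2_norm_vec_eq_sum sum_divide_distrib)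
  also have "\<dots> \<le> (\<Sum>i\<in>UNIV. (v $ i)\<^sup>2 / D_diag x i)"
    by (intro sum_mono divide_left_mono mult_pos_pos D_diag_pos D_diag_upper
        less_le_trans[OF D_diag_pos D_diag_upper]) auto
  also have "\<dots> \<le> v \<bullet> (Hhat_inv \<alpha> f W x *v v)"
    by (simp add: Hhat_inv_quadratic_form B_psd)
  finally show ?thesis .
qed

lemma Hhat_inv_upper: "v \<bullet> (Hhat_inv \<alpha> f W x *v v) \<le> Lam * (norm v)\<^sup>2"
proof -
  define z where "z = (\<chi> i. v $ i / D_diag x i)"
  have "z \<bullet> (B_mat W *v z) \<le> (\<Sum>i\<in>UNIV. 2 * (1 - W $ i $ i) * (z $ i)\<^sup>2)" by (rule B_upper)
  also have "\<dots> \<le> (\<Sum>i\<in>UNIV. \<rho> * D_diag x i * (z $ i)\<^sup>2)"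
    by (intro sum_mono mult_right_mono W_diag_le_rho) auto
  also have "\<dots> = \<rho> * (\<Sum>i\<in>UNIV. (v $ i)\<^sup>2 / D_diag x i)"
    unfolding sum_distrib_left
  proof (rule sum.cong)
    show "\<rho> * D_diag x i * (z $ i)\<^sup>2 = \<rho> * ((v $ i)\<^sup>2 / D_diag x i)" for i
      using D_diag_pos[of x i] by (simp add: z_def power2_eq_square)
  qed simp
  finally have "v \<bullet> (Hhat_inv \<alpha> f W x *v v) \<le> (1 + \<rho>) * (\<Sum>i\<in>UNIV. (v $ i)\<^sup>2 / D_diag x i)"
    by (simp add: Hhat_inv_quadratic_form z_def ring_distribs)
  also have "\<dots> \<le> (1 + \<rho>) * (\<Sum>i\<in>UNIV. (v $ i)\<^sup>2 / (2 * (1 - \<Delta>) + \<alpha> * m))"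
  proof (intro mult_left_mono sum_mono divide_left_mono mult_pos_pos)
    show "0 < 2 * (1 - \<Delta>) + \<alpha> * m" using Delta alpha_pos m_pos by (intro add_pos_pos) auto
  qed (use D_diag_pos D_diag_lower rho_pos in auto)
  also have "\<dots> = Lam * (norm v)\<^sup>2"
    by (simp add: power2_norm_vec_eq_sum sum_divide_distrib[symmetric])
  finally show ?thesis .
qed

text \<open>Controls the length of the Newton direction in the second-order term of the descent
  estimate, without any eigenvalue decomposition.\<close>

lemma norm_Hhat_inv: "(norm (Hhat_inv \<alpha> f W x *v v))\<^sup>2 \<le> Lam\<^sup>2 * (norm v)\<^sup>2"
proof (rule norm_le_of_quadratic_form_le[OF Hhat_inv_inner _ Hhat_inv_upper Lam_pos])
  show "0 \<le> v \<bullet> (Hhat_inv \<alpha> f W x *v v)" for v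
    using Hhat_inv_lower[of v x] lam_pos by (meson less_imp_le mult_nonneg_nonneg order_trans zero_le_power2)
qed

section \<open>Gradient, strong convexity and coordinatewise smoothness\<close>

definition grad :: "real ^ 'n \<Rightarrow> real ^ 'n" where
  "grad x = (mat 1 - W) *v x + \<alpha> *\<^sub>R (\<chi> i. deriv (f i) (x $ i))"

lemma GDERIV_objective: "GDERIV F x :> grad x"
proof -
  have d: "DERIV (f i) s :> deriv (f i) s" for i s
    using f_diff(1)[of i] by (simp add: DERIV_deriv_iff_real_differentiable differentiable_on_def)
  have f': "((\<lambda>x. f i (x $ i)) has_derivative (\<lambda>h. deriv (f i) (x $ i) * h $ i)) (at x)" for i
    by (rule has_derivative_compose[of "\<lambda>x. x $ i" "\<lambda>h. h $ i", OF _ d[unfolded has_field_derivative_def]])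
       (auto intro!: derivative_intros bounded_linear_imp_has_derivative bounded_linear_vec_nth)
  have A: "((*v) (mat 1 - W) has_derivative (*v) (mat 1 - W)) (at x)"
    by (intro bounded_linear_imp_has_derivative matrix_vector_mul_bounded_linear)
  have "(F has_derivative (\<lambda>h. 1/2 * (x \<bullet> ((mat 1 - W) *v h) + h \<bullet> ((mat 1 - W) *v x))
      + \<alpha> * (\<Sum>i\<in>UNIV. deriv (f i) (x $ i) * h $ i))) (at x)"
    unfolding objective_def[abs_def]
    by (intro has_derivative_add has_derivative_mult_right has_derivative_inner has_derivative_ident
        A has_derivative_sum f')
  \<comment> \<open>Symmetry of \<open>I - W\<close> merges the two product-rule terms and absorbs
    the factor 1/2.\<close>
  moreover have "1/2 * (x \<bullet> ((mat 1 - W) *v h) + h \<bullet> ((mat 1 - W) *v x))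
      + \<alpha> * (\<Sum>i\<in>UNIV. deriv (f i) (x $ i) * h $ i) = h \<bullet> grad x" for h
    using Laplacian_inner[of x h]
    by (simp add: grad_def inner_add_right inner_commute) (simp add: inner_vec_def mult_ac)
  ultimately show ?thesis by (simp add: gderiv_def)
qed

text \<open>\<open>gradient\<close> is a definite description, so uniqueness of the derivative is
  required besides its existence.\<close>

lemma gradient_objective: "gradient F x = grad x"
  unfolding gradient_def
proof (rule the_equality)
  show "GDERIV F x :> d \<Longrightarrow> d = grad x" for d
    using has_derivative_unique[of F "\<lambda>h. h \<bullet> d" x "\<lambda>h. h \<bullet> grad x"] GDERIV_objective[of x]
    by (simp add: gderiv_def fun_eq_iff vector_eq_ldot)
qed (rule GDERIV_objective)

text \<open>The quadratic part expands exactly and the remainders of the \<open>f i\<close> are kept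
  as they are, so one identity serves both the lower bound and the upper bound.\<close>

lemma objective_expand:
  "F y = F x + grad x \<bullet> (y - x) + 1/2 * ((y - x) \<bullet> ((mat 1 - W) *v (y - x)))
     + \<alpha> * (\<Sum>i\<in>UNIV. f i (y $ i) - f i (x $ i) - deriv (f i) (x $ i) * (y $ i - x $ i))"
proof -
  have "y \<bullet> ((mat 1 - W) *v y) = x \<bullet> ((mat 1 - W) *v x) + 2 * (((mat 1 - W) *v x) \<bullet> (y - x))
      + (y - x) \<bullet> ((mat 1 - W) *v (y - x))"
    using Laplacian_inner[of x y] Laplacian_inner[of y x]
    by (simp add: matrix_vector_mult_diff_distrib inner_diff_left inner_diff_right inner_commute)
  moreover have "(\<chi> i. deriv (f i) (x $ i)) \<bullet> (y - x) = (\<Sum>i\<in>UNIV. deriv (f i) (x $ i) * (y $ i - x $ i))"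
    by (simp add: inner_vec_def)
  ultimately show ?thesis
    unfolding objective_def grad_def inner_add_left inner_scaleR_left sum_subtractf right_diff_distrib
    by (simp add: right_diff_distrib)
qed

lemma strong_convexity: "F x + grad x \<bullet> (y - x) + \<alpha> * m / 2 * (norm (y - x))\<^sup>2 \<le> F y"
proof -
  have "m / 2 * (norm (y - x))\<^sup>2 = (\<Sum>i\<in>UNIV. m / 2 * (y $ i - x $ i)\<^sup>2)"
    by (simp add: power2_norm_vec_eq_sum sum_distrib_left)
  also have "\<dots> \<le> (\<Sum>i\<in>UNIV. f i (y $ i) - f i (x $ i) - deriv (f i) (x $ i) * (y $ i - x $ i))"
  proof (intro sum_mono)
    show "m / 2 * (y $ i - x $ i)\<^sup>2
        \<le> f i (y $ i) - f i (x $ i) - deriv (f i) (x $ i) * (y $ i - x $ i)" for i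
      using second_order_taylor_bounds(1)[OF f_diff f_hess_bounds, of i "x $ i" "y $ i"] by simp
  qed
  finally have "\<alpha> * (m / 2 * (norm (y - x))\<^sup>2)
      \<le> \<alpha> * (\<Sum>i\<in>UNIV. f i (y $ i) - f i (x $ i) - deriv (f i) (x $ i) * (y $ i - x $ i))"
    using alpha_pos by (intro mult_left_mono) auto
  thus ?thesis using objective_expand[of y x] Laplacian_psd[of "y - x"] by simp
qed

text \<open>Along coordinate \<open>i\<close> the quadratic part has curvature
  \<open>1 - W $ i $ i\<close>, and only the remainder of \<open>f i\<close> survives.\<close>

lemma coordinate_descent: "F (x + axis i s) \<le> F x + s * grad x $ i + s\<^sup>2 / (2 * lam)"
proof -
  have "axis i s \<bullet> ((mat 1 - W) *v axis i s) = s\<^sup>2 * (1 - W $ i $ i)"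
    by (simp add: inner_axis' matrix_vector_mult_diff_rdistrib)
       (simp add: matrix_vector_mult_def axis_def power2_eq_square if_distrib algebra_simps cong: if_cong)
  moreover have "grad x \<bullet> axis i s = s * grad x $ i" by (simp add: inner_axis)
  moreover have "(\<Sum>j\<in>UNIV. f j ((x + axis i s) $ j) - f j (x $ j)
        - deriv (f j) (x $ j) * ((x + axis i s) $ j - x $ j))
      = (\<Sum>j\<in>{i}. f j ((x + axis i s) $ j) - f j (x $ j)
        - deriv (f j) (x $ j) * ((x + axis i s) $ j - x $ j))"
    by (rule sum.mono_neutral_right) (auto simp: axis_def)
  ultimately have "F (x + axis i s) = F x + s * grad x $ i + 1/2 * (s\<^sup>2 * (1 - W $ i $ i))
      + \<alpha> * (f i (x $ i + s) - f i (x $ i) - deriv (f i) (x $ i) * s)"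
    using objective_expand[of "x + axis i s" x] by simp
  moreover have "\<alpha> * (f i (x $ i + s) - f i (x $ i) - deriv (f i) (x $ i) * s) \<le> \<alpha> * (M / 2 * s\<^sup>2)"
    using second_order_taylor_bounds(2)[OF f_diff f_hess_bounds, of i "x $ i + s" "x $ i"] alpha_pos
    by (intro mult_left_mono) auto
  \<comment> \<open>A factor 2 is given away here so that the total curvature becomes
    \<open>2 * (1 - \<delta>) + \<alpha> * M\<close>, that is \<open>1 / lam\<close>.\<close>
  moreover have "1/2 * (s\<^sup>2 * (1 - W $ i $ i)) \<le> s\<^sup>2 * (1 - \<delta>)"
  proof -
    have "s\<^sup>2 * (1 - W $ i $ i) \<le> s\<^sup>2 * (1 - \<delta>)" "0 \<le> s\<^sup>2 * (1 - \<delta>)"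
      using W_diag[of i] delta_less_1 by (auto intro!: mult_left_mono)
    thus ?thesis by linarith
  qed
  moreover have "s\<^sup>2 / (2 * lam) = s\<^sup>2 * (1 - \<delta>) + \<alpha> * (M / 2 * s\<^sup>2)"
    by (simp add: field_simps)
  ultimately show ?thesis by linarith
qed

text \<open>Completing the square in the strong convexity bound: the discarded square vanishes
  exactly where the quadratic lower model is minimal.\<close>

lemma Polyak_Lojasiewicz: "2 * (\<alpha> * m) * (F x - F y) \<le> (norm (grad x))\<^sup>2"
proof -
  define c where "c = \<alpha> * m"
  have c: "c > 0" using alpha_pos m_pos by (simp add: c_def)
  have "0 \<le> (norm (grad x + c *\<^sub>R (y - x)))\<^sup>2" by simp
  also have "\<dots> = (norm (grad x))\<^sup>2 + 2 * c * (grad x \<bullet> (y - x) + c / 2 * (norm (y - x))\<^sup>2)"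
    unfolding power2_norm_eq_inner inner_add_left inner_add_right inner_scaleR_left inner_scaleR_right
    by (simp add: algebra_simps inner_commute)
  also have "\<dots> \<le> (norm (grad x))\<^sup>2 + 2 * c * (F y - F x)"
    using strong_convexity[of x y] c by (intro add_left_mono mult_left_mono) (auto simp: c_def)
  finally show ?thesis by (simp add: c_def algebra_simps)
qed

section \<open>Existence of the minimizer and growth around it\<close>

lemma continuous_objective: "continuous_on A F"
  using GDERIV_objective
  by (intro continuous_at_imp_continuous_on)
     (auto simp: gderiv_def intro: has_derivative_continuous)

lemma minimizer_exists: "\<exists>x. \<forall>y. F x \<le> F y"
proof -
  define c where "c = \<alpha> * m / 2"
  \<comment> \<open>Beyond this radius the quadratic term in the strong convexity bound at 0
    outweighs the linear one, so \<open>F y\<close> is at least \<open>F 0\<close>; inside,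
    compactness yields a minimizer.\<close>
  define r where "r = norm (grad 0) / c"
  have c: "c > 0" using alpha_pos m_pos by (simp add: c_def)
  have r: "r \<ge> 0" using c by (simp add: r_def)
  obtain x where x: "x \<in> cball 0 r" "\<And>y. y \<in> cball 0 r \<Longrightarrow> F x \<le> F y"
    using continuous_attains_inf[OF compact_cball _ continuous_objective, of 0 r] r by auto
  have "F x \<le> F y" for y
  proof (cases "norm y \<le> r")
    case False
    have "norm (grad 0) * norm y = c * r * norm y" using c by (simp add: r_def)
    also have "\<dots> \<le> c * norm y * norm y"
      using False c by (intro mult_right_mono mult_left_mono) auto
    finally have "norm (grad 0) * norm y \<le> c * (norm y)\<^sup>2" by (simp add: power2_eq_square)
    moreover have "- (norm (grad 0) * norm y) \<le> grad 0 \<bullet> y"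
      using Cauchy_Schwarz_ineq2[of "grad 0" y] by linarith
    ultimately have "F 0 \<le> F y" using strong_convexity[of 0 y] by (simp add: c_def)
    thus ?thesis using x(2)[of 0] r by simp
  qed (use x in simp)
  thus ?thesis by blast
qed

text \<open>\<open>arg_min\<close> is a choice operator, so its minimality rests on the existence of
  a minimizer.\<close>

lemma arg_min_le: "F (arg_min F (\<lambda>_. True)) \<le> F y"
proof -
  obtain x where "\<And>y. F x \<le> F y" using minimizer_exists by blast
  thus ?thesis
    using arg_minI[of "\<lambda>_. True" x F "\<lambda>x. F x \<le> F y"] by (auto simp: not_less)
qed

text \<open>The coordinate step of size \<open>- lam * grad x $ i\<close> decreases \<open>F\<close> unless \<open>grad x $ i = 0\<close>.\<close>

lemma grad_minimizer:
  assumes "\<And>y. F x \<le> F y"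
  shows "grad x = 0"
proof -
  define l where "l = lam"
  have l: "l > 0" unfolding l_def by (rule lam_pos)
  have "grad x $ i = 0" for i
  proof -
    define s where "s = - l * grad x $ i"
    have "F x \<le> F x + s * grad x $ i + s\<^sup>2 / (2 * l)"
      using order_trans[OF assms coordinate_descent[of x i s]] by (simp only: l_def)
    also have "\<dots> = F x - l / 2 * (grad x $ i)\<^sup>2"
      unfolding s_def using l by (simp add: power2_eq_square)
    finally have "l / 2 * (grad x $ i)\<^sup>2 \<le> 0" by simp
    thus ?thesis using l by (simp add: mult_le_0_iff)
  qed
  thus ?thesis by (simp add: vec_eq_iff)
qed

lemma quadratic_growth:
  assumes "\<And>y. F xs \<le> F y"
  shows "\<alpha> * m / 2 * (norm (x - xs))\<^sup>2 \<le> F x - F xs"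
  using strong_convexity[of xs x] grad_minimizer[of xs] assms by simp

subsection \<open>One step of the method, averaged over the active agent\<close>

text \<open>The update as a deterministic function of the state and the active agent; randomness
  enters only through \<open>i\<close>.\<close>

definition newton_step :: "real \<Rightarrow> real ^ 'n \<Rightarrow> real ^ 'n \<Rightarrow> 'n \<Rightarrow> real ^ 'n" where
  "newton_step \<epsilon> p x i = x - \<epsilon> *\<^sub>R
     ((matrix_inv (diag_mat p) ** activation_mat i ** Hhat_inv \<alpha> f W x) *v gradient F x)"

lemma newton_step_eq:
  assumes "\<And>i. p $ i \<noteq> 0"
  shows "newton_step \<epsilon> p x i =
    x + axis i (- (\<epsilon> * (Hhat_inv \<alpha> f W x *v grad x) $ i / p $ i))"
  using assms
  by (simp add: newton_step_def matrix_inv_diag_mat matrix_vector_mul_assoc[symmetric]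
      gradient_objective activation_mat_def vec_eq_iff axis_def divide_inverse mult_ac)

lemma expected_newton_step:
  assumes p: "0 < pmin" "\<And>i. pmin \<le> p $ i" "(\<Sum>i\<in>UNIV. p $ i) = 1" and eps: "0 < \<epsilon>"
    and step: "\<epsilon> < 2 * pmin * (lam / Lam)\<^sup>2"
    and beta: "\<beta> = \<alpha> * m * \<epsilon> * (2 * pmin * lam\<^sup>2 - \<epsilon> * Lam\<^sup>2) / (lam * pmin)"
  shows "(\<Sum>i\<in>UNIV. p $ i * F (newton_step \<epsilon> p x i)) \<le> F x - \<beta> * (F x - F y)"
proof -
  define d where "d = Hhat_inv \<alpha> f W x *v grad x"
  define g where "g = (norm (grad x))\<^sup>2"
  define l where "l = lam"
  define L where "L = Lam"
  have pos: "l > 0" "L > 0" "\<And>i. p $ i > 0" using lam_pos Lam_pos p(1,2)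
    by (auto simp: l_def L_def intro: less_le_trans)
  \<comment> \<open>The net coefficient of \<open>g\<close>, namely \<open>\<epsilon> * l -
    \<epsilon>\<^sup>2 * L\<^sup>2 / (2 * l * pmin)\<close>. The stepsize condition makes it
    nonnegative, and \<open>\<beta> = 2 * \<alpha> * m * k\<close>.\<close>
  define k where "k = \<epsilon> * (2 * pmin * l\<^sup>2 - \<epsilon> * L\<^sup>2) / (2 * l * pmin)"
  have "\<epsilon> * L\<^sup>2 < 2 * pmin * l\<^sup>2"
    using step[folded l_def L_def] pos by (simp add: field_simps)
  hence k: "k \<ge> 0" unfolding k_def using pos p(1) eps by simp
  have "p $ i * F (newton_step \<epsilon> p x i)
      \<le> p $ i * F x - \<epsilon> * (grad x $ i * d $ i) + \<epsilon>\<^sup>2 / (2 * l * pmin) * (d $ i)\<^sup>2" for i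
  proof -
    define s where "s = - (\<epsilon> * d $ i / p $ i)"
    have "newton_step \<epsilon> p x i = x + axis i s"
      unfolding s_def d_def by (rule newton_step_eq) (use pos in \<open>auto simp: less_le\<close>)
    hence "p $ i * F (newton_step \<epsilon> p x i) \<le> p $ i * (F x + s * grad x $ i + s\<^sup>2 / (2 * l))"
      using coordinate_descent[of x i s] pos(3)[of i] by (simp add: l_def)
    also have "\<dots> = p $ i * F x - \<epsilon> * (grad x $ i * d $ i) + \<epsilon>\<^sup>2 * (d $ i)\<^sup>2 / (2 * l * p $ i)"
      using pos(1) pos(3)[of i] by (simp add: s_def field_simps power2_eq_square)
    \<comment> \<open>The weight \<open>p $ i\<close> cancels only one of the two factors
      \<open>1 / p $ i\<close> in the quadratic term; the other is bounded by
      \<open>1 / pmin\<close>.\<close>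
    also have "\<epsilon>\<^sup>2 * (d $ i)\<^sup>2 / (2 * l * p $ i) \<le> \<epsilon>\<^sup>2 * (d $ i)\<^sup>2 / (2 * l * pmin)"
      using pos(1) pos(3)[of i] p(1,2) by (intro divide_left_mono mult_left_mono mult_pos_pos) auto
    finally show ?thesis by simp
  qed
  hence "(\<Sum>i\<in>UNIV. p $ i * F (newton_step \<epsilon> p x i))
      \<le> (\<Sum>i\<in>UNIV. p $ i * F x - \<epsilon> * (grad x $ i * d $ i) + \<epsilon>\<^sup>2 / (2 * l * pmin) * (d $ i)\<^sup>2)"
    by (rule sum_mono)
  also have "\<dots> = F x - \<epsilon> * (grad x \<bullet> d) + \<epsilon>\<^sup>2 / (2 * l * pmin) * (norm d)\<^sup>2"
    unfolding sum.distrib sum_subtractf sum_distrib_left[symmetric] sum_distrib_right[symmetric] p(3)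
    by (simp add: inner_vec_def power2_norm_vec_eq_sum)
  also have "\<dots> \<le> F x - \<epsilon> * (l * g) + \<epsilon>\<^sup>2 / (2 * l * pmin) * (L\<^sup>2 * g)"
    using Hhat_inv_lower[of "grad x" x] norm_Hhat_inv[of x "grad x"] eps pos p(1)
    unfolding d_def l_def[symmetric] L_def[symmetric] g_def
    by (intro add_mono diff_mono mult_left_mono) auto
  also have "\<dots> = F x - k * g"
    using pos p(1) by (simp add: k_def field_simps power2_eq_square)
  also have "\<dots> \<le> F x - k * (2 * (\<alpha> * m) * (F x - F y))"
    using Polyak_Lojasiewicz[of x y] k by (intro diff_left_mono mult_left_mono) (auto simp: g_def)
  also have "k * (2 * (\<alpha> * m) * (F x - F y)) = \<beta> * (F x - F y)"
    using pos p(1) unfolding beta k_def l_def[symmetric] L_def[symmetric] by (simp add: field_simps)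
  finally show ?thesis .
qed

text \<open>For the upper bound, dropping the negative term of order
  \<open>\<epsilon>\<^sup>2\<close> leaves \<open>2 * \<epsilon> * \<alpha> * m * lam\<close>. This
  is below 1 because \<open>\<epsilon> < 1/2\<close> and
  \<open>\<alpha> * m * lam < 1\<close>.\<close>

lemma rate_bounds:
  assumes p: "0 < pmin" and eps: "0 < \<epsilon>" "\<epsilon> < 1/2"
    and step: "\<epsilon> < 2 * pmin * (lam / Lam)\<^sup>2"
    and beta: "\<beta> = \<alpha> * m * \<epsilon> * (2 * pmin * lam\<^sup>2 - \<epsilon> * Lam\<^sup>2) / (lam * pmin)"
  shows "0 < \<beta>" "\<beta> < 1"
proof -
  define l where "l = lam"
  define L where "L = Lam"
  have pos: "l > 0" "L > 0" using lam_pos Lam_pos by (auto simp: l_def L_def)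
  have am: "0 < \<alpha> * m" using alpha_pos m_pos by simp
  have beta': "\<beta> = \<alpha> * m * \<epsilon> * (2 * pmin * l\<^sup>2 - \<epsilon> * L\<^sup>2) / (l * pmin)"
    by (simp only: beta l_def L_def)
  have "\<epsilon> * L\<^sup>2 < 2 * pmin * l\<^sup>2"
    using step[folded l_def L_def] pos by (simp add: field_simps)
  thus "0 < \<beta>" unfolding beta' using am eps p pos by simp
  have "\<beta> = 2 * \<epsilon> * (\<alpha> * m * l) - \<alpha> * m * \<epsilon>\<^sup>2 * L\<^sup>2 / (l * pmin)"
    unfolding beta' using pos p by (simp add: field_simps power2_eq_square)
  also have "\<dots> \<le> 2 * \<epsilon> * (\<alpha> * m * l)" using pos p am by simp
  also have "\<dots> < 1 * (\<alpha> * m * l)" using eps pos am by (intro mult_strict_right_mono) auto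
  also have "\<alpha> * m * l < 1"
  proof -
    have "\<alpha> * m \<le> \<alpha> * M" using m_le_M alpha_pos by simp
    also have "\<alpha> * M < 2 * (1 - \<delta>) + \<alpha> * M" using delta_less_1 by simp
    finally have "\<alpha> * m < 2 * (1 - \<delta>) + \<alpha> * M" .
    thus ?thesis using am by (simp add: l_def)
  qed
  finally show "\<beta> < 1" by simp
qed

end

subsection \<open>Activation histories\<close>

lemma space_activation_field [simp]: "space (activation_field \<Omega> a t) = space \<Omega>"
  by (auto simp: activation_field_def space_measure_of_conv)

lemma sets_activation_field:
  "sets (activation_field \<Omega> a t) =
     sigma_sets (space \<Omega>) {a s -` A \<inter> space \<Omega> | s A. 1 \<le> s \<and> s \<le> t}"
  unfolding activation_field_def by (intro sets_measure_of) auto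

lemma subalgebra_activation_field:
  assumes "\<And>s. 1 \<le> s \<Longrightarrow> a s \<in> measurable \<Omega> (count_space UNIV)"
  shows "subalgebra \<Omega> (activation_field \<Omega> a t)"
  unfolding subalgebra_def sets_activation_field
  by (auto intro!: sets.sigma_sets_subset measurable_sets[OF assms])

lemma sets_activation_field_mono:
  "t \<le> t' \<Longrightarrow> sets (activation_field \<Omega> a t) \<subseteq> sets (activation_field \<Omega> a t')"
  unfolding sets_activation_field by (rule sigma_sets_mono') (auto intro: le_trans)

lemma simple_function_activation:
  fixes a :: "nat \<Rightarrow> 'w \<Rightarrow> 'n::finite"
  assumes "1 \<le> s" "s \<le> t"
  shows "simple_function (activation_field \<Omega> a t) (a s)"
  using assms unfolding simple_function_def sets_activation_field space_activation_field
  by (auto intro!: sigma_sets.Basic)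

lemma (in prob_space) integrable_simple_function_real:
  fixes g :: "'a \<Rightarrow> real"
  shows "simple_function M g \<Longrightarrow> integrable M g"
  by (rule integrable_simple_function) (auto simp: emeasure_eq_measure)

text \<open>The tower property, split over the finitely many values of \<open>b\<close>: each
  \<open>\<phi> (X w) i\<close> is known given \<open>N\<close>, so it factors out and the indicator
  is replaced by its conditional probability \<open>p i\<close>. As \<open>X\<close> is simple, an
  arbitrary \<open>\<phi>\<close> is admissible.\<close>

lemma (in prob_space) expectation_conditional_transition:
  fixes \<phi> :: "'b \<Rightarrow> 'n::finite \<Rightarrow> real"
  assumes sub: "subalgebra M N" and X: "simple_function N X"
    and b: "b \<in> measurable M (count_space UNIV)"
    and cond: "\<And>i. AE w in M. real_cond_exp M N (indicator {w \<in> space M. b w = i}) w = p i"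
  shows "expectation (\<lambda>w. \<phi> (X w) (b w)) = expectation (\<lambda>w. \<Sum>i\<in>UNIV. p i * \<phi> (X w) i)"
proof -
  interpret finite_measure_subalgebra M N by standard (rule sub)
  define I where "I i = {w \<in> space M. b w = i}" for i
  have I: "I i \<in> sets M" for i
    using measurable_sets[OF b, of "{i}"] by (simp add: I_def vimage_def Int_def conj_commute)
  have XM: "simple_function M X"
    using X sub by (auto simp: subalgebra_def intro: simple_function_subalgebra)
  have int_X: "integrable M (\<lambda>w. \<phi> (X w) i)" for i
    using simple_function_compose[OF XM, of "\<lambda>y. \<phi> y i"]
    by (intro integrable_simple_function_real) (simp add: comp_def)
  have int: "integrable M (\<lambda>w. \<phi> (X w) i * indicator (I i) w)" for i
    using integrable_real_mult_indicator[OF I int_X] by (simp add: mult.commute)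
  have meas: "(\<lambda>w. \<phi> (X w) i) \<in> borel_measurable N" for i
    using simple_function_compose[OF X, of "\<lambda>y. \<phi> y i"]
    by (intro borel_measurable_simple_function) (simp add: comp_def)
  have "expectation (\<lambda>w. \<phi> (X w) (b w)) = expectation (\<lambda>w. \<Sum>i\<in>UNIV. \<phi> (X w) i * indicator (I i) w)"
  proof (rule Bochner_Integration.integral_cong)
    fix w assume "w \<in> space M"
    hence "(\<Sum>i\<in>UNIV. \<phi> (X w) i * indicator (I i) w) = (\<Sum>i\<in>UNIV. if i = b w then \<phi> (X w) i else 0)"
      by (intro sum.cong) (auto simp: I_def indicator_def)
    thus "\<phi> (X w) (b w) = (\<Sum>i\<in>UNIV. \<phi> (X w) i * indicator (I i) w)" by simp
  qed simp
  also have "\<dots> = (\<Sum>i\<in>UNIV. expectation (\<lambda>w. \<phi> (X w) i * indicator (I i) w))"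
    using int by (intro Bochner_Integration.integral_sum) auto
  also have "\<dots> = (\<Sum>i\<in>UNIV. expectation (\<lambda>w. p i * \<phi> (X w) i))"
  proof (rule sum.cong)
    fix i
    have "expectation (\<lambda>w. \<phi> (X w) i * indicator (I i) w)
        = expectation (\<lambda>w. \<phi> (X w) i * real_cond_exp M N (indicator (I i)) w)"
      using int meas I by (intro real_cond_exp_intg(2)[symmetric]) auto
    also have "\<dots> = expectation (\<lambda>w. p i * \<phi> (X w) i)"
    proof (rule integral_cong_AE)
      show "(\<lambda>w. p i * \<phi> (X w) i) \<in> borel_measurable M"
        using int_X[of i] by (intro borel_measurable_times) auto
      show "(\<lambda>w. \<phi> (X w) i * real_cond_exp M N (indicator (I i)) w) \<in> borel_measurable M"
        using int_X[of i] by (intro borel_measurable_times) auto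
      show "AE w in M. \<phi> (X w) i * real_cond_exp M N (indicator (I i)) w = p i * \<phi> (X w) i"
        using cond[of i] unfolding I_def[symmetric] by eventually_elim simp
    qed
    finally show "expectation (\<lambda>w. \<phi> (X w) i * indicator (I i) w) = expectation (\<lambda>w. p i * \<phi> (X w) i)" .
  qed simp
  also have "\<dots> = expectation (\<lambda>w. \<Sum>i\<in>UNIV. p i * \<phi> (X w) i)"
    using int_X by (intro Bochner_Integration.integral_sum[symmetric]) auto
  finally show ?thesis .
qed

section \<open>Contraction in expectation along the random iterates\<close>

theorem mainTheorem2:
  fixes E :: "('n::finite \<times> 'n) set"
    and W :: "real ^ 'n ^ 'n"
    and f :: "'n \<Rightarrow> real \<Rightarrow> real"
    and p :: "real ^ 'n"
    and \<Omega> :: "'w measure"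
    and a :: "nat \<Rightarrow> 'w \<Rightarrow> 'n"
    and \<Phi> :: "nat \<Rightarrow> 'w \<Rightarrow> real ^ 'n ^ 'n"
    and x :: "nat \<Rightarrow> 'w \<Rightarrow> real ^ 'n"
    and F :: "real ^ 'n \<Rightarrow> real"
    and xstar :: "real ^ 'n"
    and \<alpha> m M L \<delta> \<Delta> pmin pmax \<epsilon> \<rho> Lam lam \<beta> :: real
  \<comment> \<open>the problem\<close>
  assumes undirected: "sym E"
    and alpha_pos: "0 < \<alpha>"
    and W_symmetric: "transpose W = W"
    and W_stochastic: "W *v 1 = 1"
    and W_null: "{v. (mat 1 - W) *v v = 0} = span {1}"
    and W_range: "\<And>i j. 0 \<le> W $ i $ j \<and> W $ i $ j < 1"
    and W_graph: "\<And>i j. i \<noteq> j \<Longrightarrow> W $ i $ j \<noteq> 0 \<longleftrightarrow> (i, j) \<in> E"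
    and F_eq: "F = objective \<alpha> f W"
    and xstar_eq: "xstar = arg_min F (\<lambda>_. True)"
  \<comment> \<open>standing assumptions\<close>
    and f_convex: "\<And>i. convex_on UNIV (f i)"
    and f_C2: "\<And>i. f i differentiable_on UNIV"
              "\<And>i. deriv (f i) differentiable_on UNIV"
              "\<And>i. continuous_on UNIV (deriv (deriv (f i)))"
    and m_pos: "0 < m"
    and f_hess_bounds: "\<And>i s. m \<le> deriv (deriv (f i)) s \<and> deriv (deriv (f i)) s \<le> M"
    and f_hess_lipschitz: "\<And>i. L-lipschitz_on UNIV (deriv (deriv (f i)))"
    and delta_bounds: "0 < \<delta>" "\<delta> \<le> \<Delta>" "\<Delta> < 1"
    and W_diag_bounds: "\<And>i. \<delta> \<le> W $ i $ i \<and> W $ i $ i \<le> \<Delta>"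
    and p_sum: "(\<Sum>i\<in>UNIV. p $ i) = 1"
    and p_bounds: "0 < pmin" "\<And>i. pmin \<le> p $ i \<and> p $ i \<le> pmax" "pmax < 1"
  \<comment> \<open>constants\<close>
    and rho_eq: "\<rho> = 2 * (1 - \<delta>) / (2 * (1 - \<delta>) + \<alpha> * m)"
    and Lam_eq: "Lam = (1 + \<rho>) / (2 * (1 - \<Delta>) + \<alpha> * m)"
    and lam_eq: "lam = 1 / (2 * (1 - \<delta>) + \<alpha> * M)"
  \<comment> \<open>the algorithm\<close>
    and prob: "prob_space \<Omega>"
    and a_measurable: "\<And>t. 1 \<le> t \<Longrightarrow> a t \<in> measurable \<Omega> (count_space UNIV)"
    and Phi_eq: "\<And>t w. 1 \<le> t \<Longrightarrow> w \<in> space \<Omega> \<Longrightarrow> \<Phi> t w = activation_mat (a t w)"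
    and Phi_cond_prob: "\<And>t i. 1 \<le> t \<Longrightarrow>
          AE w in \<Omega>. real_cond_exp \<Omega> (activation_field \<Omega> a (t - 1))
            (indicator {w \<in> space \<Omega>. \<Phi> t w = activation_mat i}) w = p $ i"
    and x_init: "\<And>w. w \<in> space \<Omega> \<Longrightarrow> x 0 w = 0"
    and x_update: "\<And>t w. 1 \<le> t \<Longrightarrow> w \<in> space \<Omega> \<Longrightarrow>
          x t w = x (t - 1) w - \<epsilon> *\<^sub>R
            ((matrix_inv (diag_mat p) ** \<Phi> t w ** Hhat_inv \<alpha> f W (x (t - 1) w))
               *v gradient F (x (t - 1) w))"
  \<comment> \<open>the stepsize and the rate\<close>
    and eps_bounds: "0 < \<epsilon>" "\<epsilon> < min (1/2) (2 * pmin * (lam / Lam)\<^sup>2)"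
    and beta_eq: "\<beta> = \<alpha> * m * \<epsilon> * (2 * pmin * lam\<^sup>2 - \<epsilon> * Lam\<^sup>2) / (lam * pmin)"
  shows "0 < \<beta> \<and> \<beta> < 1 \<and>
    (\<forall>t. integrable \<Omega> (\<lambda>w. F (x t w) - F xstar) \<and>
         integral\<^sup>L \<Omega> (\<lambda>w. F (x t w) - F xstar) \<le> (1 - \<beta>) ^ t * (F 0 - F xstar)) \<and>
    (\<forall>t. integrable \<Omega> (\<lambda>w. norm (x t w - xstar)) \<and>
         integral\<^sup>L \<Omega> (\<lambda>w. norm (x t w - xstar))
           \<le> sqrt (2 * (F 0 - F xstar) / (\<alpha> * m)) * sqrt (1 - \<beta>) ^ t)"
proof -
  interpret prob_space \<Omega> by (rule prob)
  interpret consensus_objective \<alpha> f W m M \<delta> \<Delta>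
    using alpha_pos W_symmetric W_stochastic W_range W_diag_bounds delta_bounds f_C2 f_hess_bounds m_pos
    by unfold_locales auto
  note Lam_eq = Lam_eq[unfolded rho_eq]
  have xstar: "F xstar \<le> F y" for y
    unfolding xstar_eq F_eq by (rule arg_min_le)
  have step: "\<epsilon> < 2 * pmin * (lam / Lam)\<^sup>2" and eps: "0 < \<epsilon>" "\<epsilon> < 1/2"
    using eps_bounds by auto
  note rate = rate_bounds[OF p_bounds(1) eps step[unfolded lam_eq Lam_eq] beta_eq[unfolded lam_eq Lam_eq]]
  define c where "c = \<alpha> * m / 2"
  have c: "c > 0" using alpha_pos m_pos by (simp add: c_def)

  have sub: "subalgebra \<Omega> (activation_field \<Omega> a t)" for t
    by (rule subalgebra_activation_field) (rule a_measurable)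
  have x_Suc: "x (Suc t) w = newton_step \<epsilon> p (x t w) (a (Suc t) w)" if "w \<in> space \<Omega>" for t w
    using x_update[of "Suc t" w] Phi_eq[of "Suc t" w] that by (simp add: newton_step_def F_eq)
  \<comment> \<open>The iterates are adapted: \<open>x t\<close> depends on the first
    \<open>t\<close> activations only. This is what allows conditioning on the past when agent
    \<open>a (Suc t)\<close> acts.\<close>
  have simple: "simple_function (activation_field \<Omega> a t) (x t)" for t
  proof (induction t)
    case 0
    have "simple_function (activation_field \<Omega> a 0) (\<lambda>_. 0 :: real ^ 'n)" by simp
    thus ?case by (subst simple_function_cong[where g = "\<lambda>_. 0"]) (auto simp: x_init)
  next
    case (Suc t)
    have "simple_function (activation_field \<Omega> a (Suc t)) (x t)"
      by (rule simple_function_subalgebra[OF Suc]) (simp_all add: sets_activation_field_mono)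
    hence "simple_function (activation_field \<Omega> a (Suc t)) (\<lambda>w. newton_step \<epsilon> p (x t w) (a (Suc t) w))"
      by (rule simple_function_compose2) (auto intro: simple_function_activation)
    thus ?case
      by (subst simple_function_cong[where g = "\<lambda>w. newton_step \<epsilon> p (x t w) (a (Suc t) w)"])
         (auto simp: x_Suc)
  qed
  have int: "integrable \<Omega> (\<lambda>w. \<psi> (x t w))" for \<psi> :: "real ^ 'n \<Rightarrow> real" and t
  proof -
    have "simple_function \<Omega> (x t)"
      using simple[of t] sub[of t] by (auto simp: subalgebra_def intro: simple_function_subalgebra)
    thus ?thesis
      using simple_function_compose[of \<Omega> "x t" \<psi>]
      by (intro integrable_simple_function_real) (simp add: comp_def)
  qed

  have descent: "expectation (\<lambda>w. F (x t w) - F xstar) \<le> (1 - \<beta>) ^ t * (F 0 - F xstar)" for t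
  proof (induction t)
    case 0
    have "expectation (\<lambda>w. F (x 0 w) - F xstar) = expectation (\<lambda>w. F 0 - F xstar)"
      by (rule Bochner_Integration.integral_cong) (auto simp: x_init)
    thus ?case by (simp add: prob_space)
  next
    case (Suc t)
    have cond: "AE w in \<Omega>. real_cond_exp \<Omega> (activation_field \<Omega> a t)
        (indicator {w \<in> space \<Omega>. a (Suc t) w = i}) w = p $ i" for i
    proof -
      \<comment> \<open>Distinct agents have distinct activation matrices, so the two events
        coincide.\<close>
      have "{w \<in> space \<Omega>. \<Phi> (Suc t) w = activation_mat i} = {w \<in> space \<Omega>. a (Suc t) w = i}"
        by (auto simp: Phi_eq inj_activation_mat)
      thus ?thesis using Phi_cond_prob[of "Suc t" i] by simp
    qed
    have "expectation (\<lambda>w. F (x (Suc t) w) - F xstar)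
        = expectation (\<lambda>w. F (newton_step \<epsilon> p (x t w) (a (Suc t) w)) - F xstar)"
      by (rule Bochner_Integration.integral_cong) (auto simp: x_Suc)
    \<comment> \<open>Conditioning on the first \<open>t\<close> activations freezes
      \<open>x t\<close> and averages over the next agent.\<close>
    also have "\<dots> = expectation (\<lambda>w. \<Sum>i\<in>UNIV. p $ i * (F (newton_step \<epsilon> p (x t w) i) - F xstar))"
      by (rule expectation_conditional_transition[OF sub simple a_measurable cond]) simp
    also have "\<dots> \<le> expectation (\<lambda>w. (1 - \<beta>) * (F (x t w) - F xstar))"
    proof (rule integral_mono)
      fix w
      have "(\<Sum>i\<in>UNIV. p $ i * (F (newton_step \<epsilon> p (x t w) i) - F xstar))
          = (\<Sum>i\<in>UNIV. p $ i * F (newton_step \<epsilon> p (x t w) i)) - F xstar"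
        by (simp add: right_diff_distrib sum_subtractf sum_distrib_right[symmetric] p_sum)
      also have "\<dots> \<le> F (x t w) - \<beta> * (F (x t w) - F xstar) - F xstar"
        unfolding F_eq
        by (intro diff_right_mono expected_newton_step[OF p_bounds(1) _ p_sum eps(1)
              step[unfolded lam_eq Lam_eq] beta_eq[unfolded lam_eq Lam_eq]])
           (simp add: p_bounds(2))
      finally show "(\<Sum>i\<in>UNIV. p $ i * (F (newton_step \<epsilon> p (x t w) i) - F xstar))
          \<le> (1 - \<beta>) * (F (x t w) - F xstar)"
        by (simp add: algebra_simps)
    qed (rule int)+
    also have "\<dots> = (1 - \<beta>) * expectation (\<lambda>w. F (x t w) - F xstar)" by simp
    \<comment> \<open>The induction hypothesis may be scaled because
      \<open>\<beta> < 1\<close>.\<close>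
    also have "\<dots> \<le> (1 - \<beta>) * ((1 - \<beta>) ^ t * (F 0 - F xstar))"
      using rate(2) Suc by (intro mult_left_mono) auto
    finally show ?case by (simp add: mult.assoc)
  qed

  have norm_bound: "expectation (\<lambda>w. norm (x t w - xstar))
      \<le> sqrt (2 * (F 0 - F xstar) / (\<alpha> * m)) * sqrt (1 - \<beta>) ^ t" for t
  proof -
    \<comment> \<open>Jensen's inequality for the square, in the form that a variance is
      nonnegative.\<close>
    have "(expectation (\<lambda>w. norm (x t w - xstar)))\<^sup>2 \<le> expectation (\<lambda>w. (norm (x t w - xstar))\<^sup>2)"
      using variance_eq[of "\<lambda>w. norm (x t w - xstar)"] variance_positive[of "\<lambda>w. norm (x t w - xstar)"]
        int[of "\<lambda>y. norm (y - xstar)" t] int[of "\<lambda>y. (norm (y - xstar))\<^sup>2" t]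
      by linarith
    also have "\<dots> \<le> expectation (\<lambda>w. (F (x t w) - F xstar) / c)"
    proof (rule integral_mono)
      show "(norm (x t w - xstar))\<^sup>2 \<le> (F (x t w) - F xstar) / c" for w
        using quadratic_growth[of xstar "x t w"] xstar c
        by (simp add: F_eq c_def[symmetric] pos_le_divide_eq mult.commute)
    qed (rule int)+
    also have "\<dots> = expectation (\<lambda>w. F (x t w) - F xstar) / c" by simp
    also have "\<dots> \<le> (1 - \<beta>) ^ t * (F 0 - F xstar) / c"
      using descent c by (intro divide_right_mono) auto
    also have "\<dots> = 2 * (F 0 - F xstar) / (\<alpha> * m) * (1 - \<beta>) ^ t" by (simp add: c_def)
    finally have "expectation (\<lambda>w. norm (x t w - xstar))
        \<le> sqrt (2 * (F 0 - F xstar) / (\<alpha> * m) * (1 - \<beta>) ^ t)"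
      by (rule real_le_rsqrt)
    thus ?thesis by (simp only: real_sqrt_mult real_sqrt_power)
  qed
  show ?thesis
    using rate descent norm_bound int[of "\<lambda>y. F y - F xstar"] int[of "\<lambda>y. norm (y - xstar)"] by blast
qed

end
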